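(* Let $\Psi$ be the set of noise distributions $\mu$ on $Y$ for which $R^{\mathrm{mse}}_\mu:Y\to X$ is continuous. Let $\mu:(0,\infty)\to\Psi$ be an a-priori choice of training noise with $\boldsymbol{\delta}(\mu(\delta))=\delta$ for all $\delta>0$ and $$\Delta_n(\mu(\delta))\ge \delta^2\,\ell(n)\quad\text{for all } n\in\mathbb{N},\ \delta>0,$$ with a uniform lower bound $\ell:\mathbb{N}\to\mathbb{R}$ (independent of $\delta$). For $c>0$ let $$\Phi_c=\{\nu \mid \Delta_n(\nu)\le c\cdot \ell(n)\text{ for all } n\in\mathbb{N}\},$$ where $\nu$ ranges over noise distributions on $Y$. Then for every $x\in N(A)^\perp$ and every $c>0$, $$\sup_{\nu\in\delta\cdot\Phi_c}\mathbb{E}_{\epsilon\sim\nu}\left[\left\|R^{\mathrm{mse}}_{\mu(\delta)}(Ax+\epsilon)-x\right\|^2\right]\longrightarrow 0\quad\text{as }\delta\to0.$$ Moreover, if the training noise is white, i.e. $\Delta_n(\mu(\delta))=\delta^2$ for all $n\in\mathbb{N}$ and $\delta>0$, then for every $x\in N(A)^\perp$, $$\sup_{\nu\in\Psi,\ \boldsymbol{\delta}(\nu)\le\delta}\mathbb{E}_{\epsilon\sim\nu}\left[\left\|R^{\mathrm{mse}}_{\mu(\delta)}(Ax+\epsilon)-x\right\|^2\right]\longrightarrow 0\quad\text{as }\delta\to0.$$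
   Context: $X,Y$ are (real) infinite-dimensional Hilbert spaces and $A:X\to Y$ is a compact linear operator with infinite-dimensional range and singular system $\{\sigma_n;u_n,v_n\}_{n\in\mathbb{N}}$: $\{u_n\}$ is an orthonormal basis of $N(A)^\perp$, $\{v_n\}$ is an orthonormal basis of $\overline{R(A)}$, $\sigma_n>0$, $Au_n=\sigma_n v_n$, and $\sigma_n\to 0$ (singular values in decreasing order, each of multiplicity one). $\pi^*$ is a fixed probability distribution on $X$ with trace-class covariance operator, $\mathbb{E}_{x\sim\pi^*}[\|x\|^2]<\infty$, and $\Pi_n^* := \mathbb{E}_{x\sim\pi^*}[\langle x,u_n\rangle^2]$. In particular $\sum_n \Pi_n^*<\infty$, and it is assumed that $\Pi_n^*>0$ for all $n$. A noise distribution $\mu$ on $Y$ is the law of a (possibly generalized, e.g. white-noise) random element $\epsilon$ of which only the coordinates $\langle\epsilon,v_n\rangle$, square-integrable real random variables, are used; $\Delta_n(\mu):=\mathbb{E}_{\epsilon\sim\mu}[\langle\epsilon,v_n\rangle^2]$. The noise level is $\boldsymbol{\delta}(\mu):=\sqrt{\sup_{n}\Delta_n(\mu)}$. For $t>0$ and a family $\Phi$ of noise distributions, $t\cdot\Phi$ denotes the set of laws of $t\epsilon$ with $\epsilon\sim\nu$, $\nu\in\Phi$ (so $\Delta_n$ is multiplied by $t^2$). The reconstruction operator is $$R^{\mathrm{mse}}_{\mu} y = \sum_{n\in\mathbb{N}} \frac{\sigma_n}{\sigma_n^2 + \frac{\Delta_n(\mu)}{\Pi_n^*}}\,\langle y,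 v_n\rangle u_n,$$ applied coefficientwise to noisy data: for $y=Ax+\epsilon$ one has $\langle y,v_n\rangle=\sigma_n\langle x,u_n\rangle+\langle\epsilon,v_n\rangle$, and $\|\cdot\|^2$ of an expansion in $\{u_n\}$ is the sum of the squared coefficients. Continuity of $R^{\mathrm{mse}}_\mu$ means it is a well-defined bounded linear operator on $Y$. A supremum of nonnegative quantities over the empty set is $0$. *)

theory Defs
  imports "HOL-Probability.Probability"
begin

definition infinite_dim :: "'a::real_vector set \<Rightarrow> bool" where
  "infinite_dim S \<longleftrightarrow> (\<nexists>B. finite B \<and> S \<subseteq> span B)"

definition compact_operator :: "('a::real_normed_vector \<Rightarrow> 'b::real_normed_vector) \<Rightarrow> bool" where
  "compact_operator A \<longleftrightarrow> linear A \<and> (\<forall>S. bounded S \<longrightarrow> compact (closure (A ` S)))"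

definition null_space :: "('a::real_vector \<Rightarrow> 'b::real_vector) \<Rightarrow> 'a set" where
  "null_space A = {x. A x = 0}"

definition orthonormal_seq :: "(nat \<Rightarrow> 'a::real_inner) \<Rightarrow> bool" where
  "orthonormal_seq u \<longleftrightarrow> (\<forall>i j. u i \<bullet> u j = (if i = j then 1 else 0))"

(* Orthonormal basis in the Hilbert space sense (complete orthonormal system) of a closed subspace S. *)
definition orthonormal_basis_of :: "(nat \<Rightarrow> 'a::real_inner) \<Rightarrow> 'a set \<Rightarrow> bool" where
  "orthonormal_basis_of u S \<longleftrightarrow> orthonormal_seq u \<and> closure (span (range u)) = S"

(* Strict monotonicity of s expresses "decreasing order, each of multiplicity one". *)
definition singular_system ::
  "('a::real_inner \<Rightarrow> 'b::real_inner) \<Rightarrow> (nat \<Rightarrow> real) \<Rightarrow> (nat \<Rightarrow> 'a) \<Rightarrow> (nat \<Rightarrow> 'b) \<Rightarrow> bool" where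
  "singular_system A s u v \<longleftrightarrow>
     orthonormal_basis_of u (orthogonal_comp (null_space A)) \<and>
     orthonormal_basis_of v (closure (range A)) \<and>
     (\<forall>n. s n > 0) \<and> (\<forall>n. A (u n) = s n *\<^sub>R v n) \<and>
     (\<forall>m n. m < n \<longrightarrow> s n < s m) \<and> s \<longlonglongrightarrow> 0"

definition covariance_form :: "'a::real_inner measure \<Rightarrow> 'a \<Rightarrow> 'a \<Rightarrow> real" where
  "covariance_form P h k =
     (\<integral>x. (x \<bullet> h - (\<integral>z. z \<bullet> h \<partial>P)) * (x \<bullet> k - (\<integral>z. z \<bullet> k \<partial>P)) \<partial>P)"

(* The covariance operator C is the bounded operator representing the covariance form. It is
   positive, so it is trace class iff the sums of (C e) \<bullet> e over orthonormal systems are finite. *)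
definition trace_class_covariance :: "'a::real_inner measure \<Rightarrow> bool" where
  "trace_class_covariance P \<longleftrightarrow>
     (\<exists>C. bounded_linear C \<and> (\<forall>h k. C h \<bullet> k = covariance_form P h k) \<and>
       (\<forall>B. pairwise orthogonal B \<and> (\<forall>e\<in>B. norm e = 1) \<longrightarrow> (\<lambda>e. C e \<bullet> e) summable_on B))"

definition prior_distribution :: "'a::real_inner measure \<Rightarrow> bool" where
  "prior_distribution P \<longleftrightarrow>
     prob_space P \<and> sets P = sets borel \<and>
     integrable P (\<lambda>x. (norm x)\<^sup>2) \<and> trace_class_covariance P"

definition prior_moment :: "'a::real_inner measure \<Rightarrow> (nat \<Rightarrow> 'a) \<Rightarrow> nat \<Rightarrow> real" where
  "prior_moment P u n = (\<integral>x. (x \<bullet> u n)\<^sup>2 \<partial>P)"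

(* A (possibly generalized) noise element enters only through its coordinates with respect to the
   v n, so a noise distribution is represented by the joint law of its coordinate sequence, a
   probability measure on the product space of real sequences. The element itself need not have
   square-summable coordinates (white noise). *)
type_synonym noise = "(nat \<Rightarrow> real) measure"

definition noise_distribution :: "noise \<Rightarrow> bool" where
  "noise_distribution \<mu> \<longleftrightarrow>
     prob_space \<mu> \<and> sets \<mu> = sets (Pi\<^sub>M UNIV (\<lambda>_. borel)) \<and>
     (\<forall>n. integrable \<mu> (\<lambda>e. (e n)\<^sup>2))"

definition noise_moment :: "noise \<Rightarrow> nat \<Rightarrow> real" where
  "noise_moment \<mu> n = (\<integral>e. (e n)\<^sup>2 \<partial>\<mu>)"

(* The supremum may be infinite, in which case the noise level is infinite. *)
definition noise_level :: "noise \<Rightarrow> ereal" where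
  "noise_level \<mu> =
     (if bdd_above (range (noise_moment \<mu>)) then ereal (sqrt (SUP n. noise_moment \<mu> n)) else \<infinity>)"

definition scale_noise :: "real \<Rightarrow> noise set \<Rightarrow> noise set" where
  "scale_noise t \<Phi> = (\<lambda>\<nu>. distr \<nu> (Pi\<^sub>M UNIV (\<lambda>_. borel)) (\<lambda>e n. t * e n)) ` \<Phi>"

(* Maps the coordinates y n of the data with respect to v to the coefficients of the
   reconstruction with respect to u. *)
definition mse_coeff ::
  "(nat \<Rightarrow> real) \<Rightarrow> (nat \<Rightarrow> 'a::real_inner) \<Rightarrow> 'a measure \<Rightarrow> noise \<Rightarrow> (nat \<Rightarrow> real) \<Rightarrow> nat \<Rightarrow> real" where
  "mse_coeff s u P \<mu> y n =
     s n / ((s n)\<^sup>2 + noise_moment \<mu> n / prior_moment P u n) * y n"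

definition R_mse ::
  "(nat \<Rightarrow> real) \<Rightarrow> (nat \<Rightarrow> 'a::real_inner) \<Rightarrow> (nat \<Rightarrow> 'b::real_inner) \<Rightarrow> 'a measure \<Rightarrow> noise \<Rightarrow> 'b \<Rightarrow> 'a"
  where
  "R_mse s u v P \<mu> y = (\<Sum>n. mse_coeff s u P \<mu> (\<lambda>k. y \<bullet> v k) n *\<^sub>R u n)"

definition continuous_noise ::
  "(nat \<Rightarrow> real) \<Rightarrow> (nat \<Rightarrow> 'a::real_inner) \<Rightarrow> (nat \<Rightarrow> 'b::real_inner) \<Rightarrow> 'a measure \<Rightarrow> noise set" where
  "continuous_noise s u v P =
     {\<mu>. noise_distribution \<mu> \<and>
         (\<forall>y. summable (\<lambda>n. mse_coeff s u P \<mu> (\<lambda>k. y \<bullet> v k) n *\<^sub>R u n)) \<and>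
         bounded_linear (R_mse s u v P \<mu>)}"

definition dominated_noise :: "(nat \<Rightarrow> real) \<Rightarrow> real \<Rightarrow> noise set" where
  "dominated_noise l c = {\<nu>. noise_distribution \<nu> \<and> (\<forall>n. noise_moment \<nu> n \<le> c * l n)}"

(* Expected squared norm of R(A x + e) - x for e distributed as \<nu> and R trained on \<mu>, where the
   squared norm is the (possibly infinite) sum of the squared coefficients with respect to u.
   Used only for x in the closed span of the u n. *)
definition mse_risk ::
  "('a \<Rightarrow> 'b) \<Rightarrow> (nat \<Rightarrow> real) \<Rightarrow> (nat \<Rightarrow> 'a::real_inner) \<Rightarrow> (nat \<Rightarrow> 'b::real_inner) \<Rightarrow> 'a measure \<Rightarrow>
    noise \<Rightarrow> 'a \<Rightarrow> noise \<Rightarrow> ennreal" where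
  "mse_risk A s u v P \<mu> x \<nu> =
     (\<integral>\<^sup>+e. (\<Sum>n. ennreal ((mse_coeff s u P \<mu> (\<lambda>k. A x \<bullet> v k + e k) n - x \<bullet> u n)\<^sup>2)) \<partial>\<nu>)"

end

theory Submission
  imports Defs
begin

text \<open>
  Everything happens mode by mode in the singular basis. With the weights
  \<open>r\<^sub>n = \<sigma>\<^sub>n / (\<sigma>\<^sub>n\<^sup>2 + D\<^sub>n / \<Pi>\<^sub>n)\<close>, where \<open>D\<^sub>n\<close> and \<open>\<Pi>\<^sub>n\<close> are the second moments of
  the training noise and of the prior, the \<open>n\<close>-th coefficient of the error is
  \<open>(r\<^sub>n \<sigma>\<^sub>n - 1) x\<^sub>n + r\<^sub>n e\<^sub>n\<close>: the data coefficient \<open>A x \<bullet> v\<^sub>n\<close> equals \<open>\<sigma>\<^sub>n x\<^sub>n\<close>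
  (\<open>inner_singular_vector\<close>). The noise need not be centred, so the cross term may survive; it is
  absorbed by \<open>(a + b)\<^sup>2 \<le> 2 a\<^sup>2 + 2 b\<^sup>2\<close>.

  Both suprema range over noise whose moments are at most \<open>c D\<^sub>n\<close>: in the first claim because
  \<open>\<delta>\<^sup>2 c l(n) \<le> c D\<^sub>n\<close>, in the second one, with \<open>c = 1\<close>, because white training noise attains the
  noise level in every coordinate. Hence the risk is bounded, uniformly over the admissible noise,
  by the sum over \<open>n\<close> of \<open>2 (r\<^sub>n \<sigma>\<^sub>n - 1)\<^sup>2 x\<^sub>n\<^sup>2 + 2 c D\<^sub>n r\<^sub>n\<^sup>2\<close>.

  This sum tends to zero by dominated convergence. Each term does, since \<open>0 \<le> D\<^sub>n \<le> \<delta>\<^sup>2\<close> and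
  \<open>\<sigma>\<^sub>n > 0\<close> is fixed. The terms are dominated by \<open>2 x\<^sub>n\<^sup>2 + 2 c \<Pi>\<^sub>n\<close>: the bias factor lies in
  \<open>[-1, 0]\<close>, and \<open>D\<^sub>n r\<^sub>n\<^sup>2 = \<Pi>\<^sub>n \<sigma>\<^sub>n\<^sup>2 (D\<^sub>n / \<Pi>\<^sub>n) / (\<sigma>\<^sub>n\<^sup>2 + D\<^sub>n / \<Pi>\<^sub>n)\<^sup>2 \<le> \<Pi>\<^sub>n\<close>. Finally \<open>x\<^sub>n\<^sup>2\<close> and
  \<open>\<Pi>\<^sub>n\<close> are summable by Bessel's inequality, applied to \<open>x\<close> and under the expectation of the
  prior (\<open>summable_prior_moment\<close>).
\<close>

section \<open>Bessel's inequality and the prior moments\<close>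

lemma bessel_inequality:
  fixes u :: "nat \<Rightarrow> 'a::real_inner"
  assumes "orthonormal_seq u"
  shows "(\<Sum>n<N. (x \<bullet> u n)\<^sup>2) \<le> (norm x)\<^sup>2"
proof -
  define p where "p = (\<Sum>n<N. (x \<bullet> u n) *\<^sub>R u n)"
  have xp: "x \<bullet> p = (\<Sum>n<N. (x \<bullet> u n)\<^sup>2)"
    by (simp add: p_def inner_sum_right power2_eq_square)
  have up: "u n \<bullet> p = x \<bullet> u n" if "n < N" for n
  proof -
    have "u n \<bullet> p = (\<Sum>k<N. if k = n then x \<bullet> u n else 0)"
      unfolding p_def inner_sum_right
      by (rule sum.cong) (use assms in \<open>auto simp: orthonormal_seq_def\<close>)
    with that show ?thesis
      by simp
  qed
  have pp: "p \<bullet> p = (\<Sum>n<N. (x \<bullet> u n)\<^sup>2)"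
    by (subst p_def) (simp add: inner_sum_left up power2_eq_square)
  have "0 \<le> (x - p) \<bullet> (x - p)"
    by simp
  also have "\<dots> = (norm x)\<^sup>2 - (\<Sum>n<N. (x \<bullet> u n)\<^sup>2)"
    using xp pp by (simp add: inner_diff_left inner_diff_right inner_commute power2_norm_eq_inner)
  finally show ?thesis
    by simp
qed

lemma summable_coefficients_squared:
  fixes u :: "nat \<Rightarrow> 'a::real_inner"
  assumes "orthonormal_seq u"
  shows "summable (\<lambda>n. (x \<bullet> u n)\<^sup>2)"
  by (rule summableI_nonneg_bounded) (use bessel_inequality[OF assms] in auto)

lemma summable_prior_moment:
  assumes P: "prior_distribution P" and u: "orthonormal_seq u"
  shows "summable (prior_moment P u)"
proof (rule summableI_nonneg_bounded)
  have int: "integrable P (\<lambda>x. (norm x)\<^sup>2)" and sets: "sets P = sets borel"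
    using P by (auto simp: prior_distribution_def)
  have int_coeff: "integrable P (\<lambda>x. (x \<bullet> u n)\<^sup>2)" for n
  proof (rule Bochner_Integration.integrable_bound[OF int])
    have "(\<lambda>x. (x \<bullet> u n)\<^sup>2) \<in> borel_measurable borel"
      by (intro borel_measurable_continuous_onI continuous_intros)
    then show "(\<lambda>x. (x \<bullet> u n)\<^sup>2) \<in> borel_measurable P"
      by (simp cong: measurable_cong_sets add: sets)
    have "(x \<bullet> u n)\<^sup>2 \<le> (norm x)\<^sup>2" for x
    proof -
      have "\<bar>x \<bullet> u n\<bar> \<le> norm x * norm (u n)"
        by (rule Cauchy_Schwarz_ineq2)
      moreover have "norm (u n) = 1"
        using u by (simp add: orthonormal_seq_def norm_eq_sqrt_inner)
      ultimately show ?thesis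
        by (simp add: abs_le_square_iff[symmetric])
    qed
    then show "AE x in P. norm ((x \<bullet> u n)\<^sup>2) \<le> norm ((norm x)\<^sup>2)"
      by simp
  qed
  show "0 \<le> prior_moment P u n" for n
    by (simp add: prior_moment_def)
  show "(\<Sum>n<N. prior_moment P u n) \<le> (\<integral>x. (norm x)\<^sup>2 \<partial>P)" for N
  proof -
    have "(\<Sum>n<N. prior_moment P u n) = (\<integral>x. (\<Sum>n<N. (x \<bullet> u n)\<^sup>2) \<partial>P)"
      unfolding prior_moment_def by (simp add: int_coeff)
    also have "\<dots> \<le> (\<integral>x. (norm x)\<^sup>2 \<partial>P)"
      by (rule integral_mono) (use int_coeff int bessel_inequality[OF u] in auto)
    finally show ?thesis .
  qed
qed

section \<open>Noise-free data in the singular basis\<close>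

lemma compact_operator_bounded_linear:
  assumes "compact_operator A"
  shows "bounded_linear A"
proof -
  have lin: "linear A" and "compact (closure (A ` cball 0 1))"
    using assms by (auto simp: compact_operator_def)
  then have "bounded (A ` cball 0 1)"
    by (intro bounded_subset[OF compact_imp_bounded closure_subset])
  then obtain K where "\<forall>x\<in>cball 0 1. norm (A x) \<le> K"
    by (auto simp: bounded_iff)
  then have K: "norm (A x) \<le> K" if "norm x \<le> 1" for x
    using that by simp
  have "norm (A x) \<le> norm x * K" for x
  proof (cases "x = 0")
    case True
    then show ?thesis
      using linear_0[OF lin] by simp
  next
    case False
    have "norm (A (inverse (norm x) *\<^sub>R x)) \<le> K"
      by (rule K) (use False in simp)
    with False show ?thesis
      by (simp add: linear_scale[OF lin] field_simps)
  qed
  then show ?thesis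
    using lin by (intro bounded_linear_intro[of _ K]) (auto simp: linear_add linear_scale)
qed

text \<open>
  The identity holds for each \<open>x = u k\<close>, and both sides are continuous and linear in \<open>x\<close>, so it
  extends to the closed span of the \<open>u k\<close>.
\<close>

lemma inner_singular_vector:
  assumes "compact_operator A" and sys: "singular_system A s u v"
    and x: "x \<in> orthogonal_comp (null_space A)"
  shows "A x \<bullet> v n = s n * (x \<bullet> u n)"
proof -
  interpret A: bounded_linear A
    using assms(1) by (rule compact_operator_bounded_linear)
  define S where "S = {x. A x \<bullet> v n = s n * (x \<bullet> u n)}"
  have "u k \<in> S" for k
    using sys by (auto simp: S_def singular_system_def orthonormal_basis_of_def orthonormal_seq_def)
  moreover have "subspace S"
    by (rule subspaceI) (auto simp: S_def A.zero A.add A.scaleR inner_add_left algebra_simps)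
  ultimately have "span (range u) \<subseteq> S"
    by (intro span_minimal) auto
  moreover have "closed S"
    unfolding S_def by (intro closed_Collect_eq continuous_intros A.continuous_on)
  ultimately have "closure (span (range u)) \<subseteq> S"
    by (rule closure_minimal)
  moreover have "closure (span (range u)) = orthogonal_comp (null_space A)"
    using sys by (simp add: singular_system_def orthonormal_basis_of_def)
  ultimately show ?thesis
    using x by (auto simp: S_def)
qed

section \<open>The error in a single mode\<close>

text \<open>
  Bias and variance bound for a mode with singular value \<open>\<sigma>\<close>, prior moment \<open>p\<close>, training noise
  moment \<open>d\<close>, true coefficient \<open>a\<close>, and test noise moment at most \<open>c * d\<close>.
\<close>

definition mode_bound :: "real \<Rightarrow> real \<Rightarrow> real \<Rightarrow> real \<Rightarrow> real \<Rightarrow> real" where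
  "mode_bound c \<sigma> p a d =
     2 * (\<sigma> / (\<sigma>\<^sup>2 + d / p) * \<sigma> - 1)\<^sup>2 * a\<^sup>2 + 2 * (c * d) * (\<sigma> / (\<sigma>\<^sup>2 + d / p))\<^sup>2"

lemma mode_bound_nonneg: "0 \<le> c \<Longrightarrow> 0 \<le> d \<Longrightarrow> 0 \<le> mode_bound c \<sigma> p a d"
  by (simp add: mode_bound_def)

text \<open>
  The reason why the variance term has a majorant not involving the training noise is
  \<open>\<sigma>\<^sup>2 t \<le> (\<sigma>\<^sup>2 + t)\<^sup>2\<close> with \<open>t = d / p\<close>.
\<close>

lemma mode_bound_le:
  assumes "0 < \<sigma>" "0 < p" "0 \<le> d" "0 \<le> c"
  shows "mode_bound c \<sigma> p a d \<le> 2 * a\<^sup>2 + 2 * c * p"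
proof -
  define t where "t = d / p"
  have t: "0 \<le> t" and d: "d = p * t"
    using assms by (auto simp: t_def)
  have pos: "0 < \<sigma>\<^sup>2 + t"
    using assms t by (simp add: add_pos_nonneg)
  have "\<sigma> / (\<sigma>\<^sup>2 + t) * \<sigma> - 1 = - (t / (\<sigma>\<^sup>2 + t))"
    using pos by (simp add: field_simps power2_eq_square)
  moreover have "(t / (\<sigma>\<^sup>2 + t))\<^sup>2 \<le> 1"
    using pos t by (simp add: abs_square_le_1 divide_le_eq)
  ultimately have bias: "(\<sigma> / (\<sigma>\<^sup>2 + t) * \<sigma> - 1)\<^sup>2 \<le> 1"
    by simp
  have "\<sigma>\<^sup>2 * t \<le> (\<sigma>\<^sup>2 + t)\<^sup>2"
    using t by (simp add: power2_sum)
  then have "t * (\<sigma> / (\<sigma>\<^sup>2 + t))\<^sup>2 \<le> 1"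
    using pos by (simp add: power_divide divide_le_eq mult.commute)
  then have "2 * (c * p) * (t * (\<sigma> / (\<sigma>\<^sup>2 + t))\<^sup>2) \<le> 2 * (c * p) * 1"
    using assms by (intro mult_left_mono) auto
  moreover have "2 * (\<sigma> / (\<sigma>\<^sup>2 + t) * \<sigma> - 1)\<^sup>2 * a\<^sup>2 \<le> 2 * 1 * a\<^sup>2"
    using bias by (intro mult_right_mono mult_left_mono) auto
  ultimately show ?thesis
    unfolding mode_bound_def t_def[symmetric] by (simp add: d mult_ac)
qed

lemma mode_bound_tendsto_0:
  assumes "0 < \<sigma>" "0 < p" and "(d \<longlongrightarrow> 0) F"
  shows "((\<lambda>t. mode_bound c \<sigma> p a (d t)) \<longlongrightarrow> 0) F"
proof -
  have "((\<lambda>t. mode_bound c \<sigma> p a (d t)) \<longlongrightarrow> mode_bound c \<sigma> p a 0) F"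
    unfolding mode_bound_def using assms by (intro tendsto_intros) auto
  moreover have "mode_bound c \<sigma> p a 0 = 0"
    using assms by (simp add: mode_bound_def power2_eq_square)
  ultimately show ?thesis
    by simp
qed

lemma affine_second_moment_le:
  fixes \<nu> :: noise
  assumes \<nu>: "noise_distribution \<nu>"
  shows "(\<integral>\<^sup>+e. ennreal ((b + r * e n)\<^sup>2) \<partial>\<nu>) \<le> ennreal (2 * b\<^sup>2 + 2 * r\<^sup>2 * noise_moment \<nu> n)"
proof -
  interpret prob_space \<nu>
    using \<nu> by (simp add: noise_distribution_def)
  have int: "integrable \<nu> (\<lambda>e. (e n)\<^sup>2)"
    using \<nu> by (simp add: noise_distribution_def)
  have "(b + r * y)\<^sup>2 \<le> 2 * b\<^sup>2 + 2 * r\<^sup>2 * y\<^sup>2" for y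
    using sum_squares_bound[of b "r * y"] by (simp add: power2_sum power_mult_distrib)
  then have "(\<integral>\<^sup>+e. ennreal ((b + r * e n)\<^sup>2) \<partial>\<nu>) \<le> (\<integral>\<^sup>+e. ennreal (2 * b\<^sup>2 + 2 * r\<^sup>2 * (e n)\<^sup>2) \<partial>\<nu>)"
    by (intro nn_integral_mono ennreal_leI)
  also have "\<dots> = ennreal (\<integral>e. 2 * b\<^sup>2 + 2 * r\<^sup>2 * (e n)\<^sup>2 \<partial>\<nu>)"
    by (intro nn_integral_eq_integral) (use int in auto)
  also have "(\<integral>e. 2 * b\<^sup>2 + 2 * r\<^sup>2 * (e n)\<^sup>2 \<partial>\<nu>) = 2 * b\<^sup>2 + 2 * r\<^sup>2 * noise_moment \<nu> n"
    using int by (simp add: noise_moment_def prob_space)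
  finally show ?thesis .
qed

section \<open>The risk\<close>

lemma mse_risk_le:
  assumes data: "\<And>n. A x \<bullet> v n = s n * (x \<bullet> u n)"
    and \<nu>: "noise_distribution \<nu>"
    and moment: "\<And>n. noise_moment \<nu> n \<le> c * noise_moment \<mu> n"
  shows "mse_risk A s u v P \<mu> x \<nu> \<le>
    (\<Sum>n. ennreal (mode_bound c (s n) (prior_moment P u n) (x \<bullet> u n) (noise_moment \<mu> n)))"
proof -
  define r where "r n = s n / ((s n)\<^sup>2 + noise_moment \<mu> n / prior_moment P u n)" for n
  have sets: "sets \<nu> = sets (Pi\<^sub>M UNIV (\<lambda>_. borel))"
    using \<nu> by (simp add: noise_distribution_def)
  have meas: "(\<lambda>e. e n) \<in> borel_measurable \<nu>" for n
    using measurable_component_singleton[of n UNIV "\<lambda>_. borel :: real measure"]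
    by (simp cong: measurable_cong_sets add: sets)
  have err: "mse_coeff s u P \<mu> (\<lambda>k. A x \<bullet> v k + e k) n - x \<bullet> u n
      = (r n * s n - 1) * (x \<bullet> u n) + r n * e n" for e n
    by (simp add: mse_coeff_def r_def[symmetric] data algebra_simps)
  have "mse_risk A s u v P \<mu> x \<nu>
      = (\<Sum>n. \<integral>\<^sup>+e. ennreal (((r n * s n - 1) * (x \<bullet> u n) + r n * e n)\<^sup>2) \<partial>\<nu>)"
    unfolding mse_risk_def err using meas by (intro nn_integral_suminf) measurable
  also have "\<dots> \<le> (\<Sum>n. ennreal (mode_bound c (s n) (prior_moment P u n) (x \<bullet> u n) (noise_moment \<mu> n)))"
  proof (intro suminf_le summableI)
    fix n
    have "2 * ((r n * s n - 1) * (x \<bullet> u n))\<^sup>2 + 2 * (r n)\<^sup>2 * noise_moment \<nu> n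
        \<le> 2 * ((r n * s n - 1) * (x \<bullet> u n))\<^sup>2 + 2 * (r n)\<^sup>2 * (c * noise_moment \<mu> n)"
      using moment[of n] by (intro add_left_mono mult_left_mono) auto
    also have "\<dots> = mode_bound c (s n) (prior_moment P u n) (x \<bullet> u n) (noise_moment \<mu> n)"
      unfolding mode_bound_def r_def[symmetric] by (simp add: power_mult_distrib mult_ac)
    finally show "(\<integral>\<^sup>+e. ennreal (((r n * s n - 1) * (x \<bullet> u n) + r n * e n)\<^sup>2) \<partial>\<nu>)
        \<le> ennreal (mode_bound c (s n) (prior_moment P u n) (x \<bullet> u n) (noise_moment \<mu> n))"
      using affine_second_moment_le[OF \<nu>] by (meson ennreal_leI order_trans)
  qed
  finally show ?thesis .
qed

text \<open>
  This is the common core of both claims: the bound of the risk no longer depends on the test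
  noise, and dominated convergence for series makes it vanish.
\<close>

lemma sup_mse_risk_tendsto_0:
  fixes \<mu> :: "real \<Rightarrow> noise" and N :: "real \<Rightarrow> noise set"
  assumes data: "\<And>n. A x \<bullet> v n = s n * (x \<bullet> u n)"
    and u: "orthonormal_seq u" and s: "\<And>n. 0 < s n"
    and P: "prior_distribution P" "\<And>n. 0 < prior_moment P u n"
    and c: "0 \<le> c"
    and \<mu>: "\<And>\<delta> n. 0 < \<delta> \<Longrightarrow> noise_moment (\<mu> \<delta>) n \<le> \<delta>\<^sup>2"
    and N: "\<And>\<delta> \<nu>. 0 < \<delta> \<Longrightarrow> \<nu> \<in> N \<delta> \<Longrightarrow> noise_distribution \<nu>"
      "\<And>\<delta> \<nu> n. 0 < \<delta> \<Longrightarrow> \<nu> \<in> N \<delta> \<Longrightarrow> noise_moment \<nu> n \<le> c * noise_moment (\<mu> \<delta>) n"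
  shows "((\<lambda>\<delta>. SUP \<nu>\<in>N \<delta>. mse_risk A s u v P (\<mu> \<delta>) x \<nu>) \<longlongrightarrow> 0) (at_right 0)"
proof -
  define b where "b \<delta> n =
    mode_bound c (s n) (prior_moment P u n) (x \<bullet> u n) (noise_moment (\<mu> \<delta>) n)" for \<delta> n
  define h where "h n = 2 * (x \<bullet> u n)\<^sup>2 + 2 * c * prior_moment P u n" for n
  have D0: "0 \<le> noise_moment (\<mu> \<delta>) n" for \<delta> n
    by (simp add: noise_moment_def)
  have b0: "0 \<le> b \<delta> n" for \<delta> n
    unfolding b_def by (rule mode_bound_nonneg[OF c D0])
  have bh: "b \<delta> n \<le> h n" for \<delta> n
    unfolding b_def h_def by (rule mode_bound_le[OF s P(2) D0 c])
  have h: "summable h"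
    unfolding h_def
    by (intro summable_add summable_mult summable_coefficients_squared[OF u]
        summable_prior_moment[OF P(1) u])
  have D: "((\<lambda>\<delta>. noise_moment (\<mu> \<delta>) n) \<longlongrightarrow> 0) (at_right 0)" for n
  proof (rule tendsto_sandwich[of "\<lambda>_. 0" _ _ "\<lambda>\<delta>. \<delta>\<^sup>2"])
    show "\<forall>\<^sub>F \<delta> in at_right 0. noise_moment (\<mu> \<delta>) n \<le> \<delta>\<^sup>2"
      using \<mu> by (auto simp: eventually_at_filter)
    show "((\<lambda>\<delta>::real. \<delta>\<^sup>2) \<longlongrightarrow> 0) (at_right 0)"
      by (auto intro!: tendsto_eq_intros)
  qed (use D0 in auto)
  have "((\<lambda>\<delta>. \<Sum>n. b \<delta> n) \<longlongrightarrow> (\<Sum>n. 0)) (at_right 0)"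
  proof (rule tannerys_theorem[THEN conjunct2, THEN conjunct2])
    show "((\<lambda>\<delta>. b \<delta> n) \<longlongrightarrow> 0) (at_right 0)" for n
      unfolding b_def by (rule mode_bound_tendsto_0[OF s P(2) D])
    show "\<forall>\<^sub>F (n, \<delta>) in at_top \<times>\<^sub>F at_right 0. norm (b \<delta> n) \<le> h n"
      using b0 bh by (intro always_eventually) auto
  qed (use h in auto)
  then have lim: "((\<lambda>\<delta>. ennreal (\<Sum>n. b \<delta> n)) \<longlongrightarrow> 0) (at_right 0)"
    using tendsto_ennrealI by fastforce
  have le: "(SUP \<nu>\<in>N \<delta>. mse_risk A s u v P (\<mu> \<delta>) x \<nu>) \<le> ennreal (\<Sum>n. b \<delta> n)"
    if "0 < \<delta>" for \<delta>
  proof (rule SUP_least)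
    fix \<nu> assume \<nu>: "\<nu> \<in> N \<delta>"
    have "mse_risk A s u v P (\<mu> \<delta>) x \<nu> \<le> (\<Sum>n. ennreal (b \<delta> n))"
      unfolding b_def by (rule mse_risk_le[where A = A, OF data N(1)[OF that \<nu>] N(2)[OF that \<nu>]])
    also have "\<dots> = ennreal (\<Sum>n. b \<delta> n)"
      by (rule suminf_ennreal2[OF b0])
        (rule summable_comparison_test'[OF h], use b0 bh in auto)
    finally show "mse_risk A s u v P (\<mu> \<delta>) x \<nu> \<le> ennreal (\<Sum>n. b \<delta> n)" .
  qed
  show ?thesis
    by (rule tendsto_sandwich[OF _ _ tendsto_const lim])
      (use le in \<open>auto simp: eventually_at_filter\<close>)
qed

section \<open>Admissible test noise\<close>

lemma scaled_noise:
  fixes \<nu> :: noise and t :: real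
  assumes \<nu>: "noise_distribution \<nu>"
  defines "\<nu>' \<equiv> distr \<nu> (Pi\<^sub>M UNIV (\<lambda>_. borel)) (\<lambda>e n. t * e n)"
  shows "noise_distribution \<nu>'" and "noise_moment \<nu>' n = t\<^sup>2 * noise_moment \<nu> n"
proof -
  interpret prob_space \<nu>
    using \<nu> by (simp add: noise_distribution_def)
  have sets: "sets \<nu> = sets (Pi\<^sub>M UNIV (\<lambda>_. borel))"
    and int: "integrable \<nu> (\<lambda>e. (e k)\<^sup>2)" for k
    using \<nu> by (auto simp: noise_distribution_def)
  have "(\<lambda>e k. t * e k) \<in> Pi\<^sub>M UNIV (\<lambda>_. borel) \<rightarrow>\<^sub>M Pi\<^sub>M UNIV (\<lambda>_. borel :: real measure)"
    by (rule measurable_PiM_single') (auto simp: space_PiM)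
  then have meas: "(\<lambda>e k. t * e k) \<in> \<nu> \<rightarrow>\<^sub>M Pi\<^sub>M UNIV (\<lambda>_. borel)"
    by (simp cong: measurable_cong_sets add: sets)
  have "integrable \<nu>' (\<lambda>e. (e k)\<^sup>2)" for k
    unfolding \<nu>'_def using int[of k] meas
    by (subst integrable_distr_eq) (auto simp: power_mult_distrib)
  then show "noise_distribution \<nu>'"
    using prob_space_distr[OF meas] by (simp add: noise_distribution_def \<nu>'_def)
  show "noise_moment \<nu>' n = t\<^sup>2 * noise_moment \<nu> n"
    unfolding \<nu>'_def noise_moment_def using meas
    by (subst integral_distr) (auto simp: power_mult_distrib)
qed

lemma noise_moment_le_level:
  assumes "noise_level \<mu> \<le> ereal \<delta>"
  shows "noise_moment \<mu> n \<le> \<delta>\<^sup>2"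
proof -
  have bdd: "bdd_above (range (noise_moment \<mu>))" and "sqrt (SUP n. noise_moment \<mu> n) \<le> \<delta>"
    using assms by (auto simp: noise_level_def split: if_splits)
  then have "(SUP n. noise_moment \<mu> n) \<le> \<delta>\<^sup>2"
    using sqrt_le_D by blast
  moreover have "noise_moment \<mu> n \<le> (SUP n. noise_moment \<mu> n)"
    by (rule cSUP_upper[OF _ bdd]) simp
  ultimately show ?thesis
    by simp
qed

theorem theorem2:
  fixes A :: "'a::{real_inner,complete_space} \<Rightarrow> 'b::{real_inner,complete_space}"
    and s :: "nat \<Rightarrow> real" and u :: "nat \<Rightarrow> 'a" and v :: "nat \<Rightarrow> 'b"
    and P :: "'a measure"
    and \<mu> :: "real \<Rightarrow> noise"
  assumes "infinite_dim (UNIV :: 'a set)" and "infinite_dim (UNIV :: 'b set)"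
    and "compact_operator A" and "infinite_dim (range A)"
    and "singular_system A s u v"
    and "prior_distribution P" and "\<And>n. prior_moment P u n > 0"
    and "\<And>\<delta>. \<delta> > 0 \<Longrightarrow> \<mu> \<delta> \<in> continuous_noise s u v P"
    and "\<And>\<delta>. \<delta> > 0 \<Longrightarrow> noise_level (\<mu> \<delta>) = ereal \<delta>"
  shows "(\<forall>l :: nat \<Rightarrow> real. (\<forall>\<delta>>0. \<forall>n. noise_moment (\<mu> \<delta>) n \<ge> \<delta>\<^sup>2 * l n) \<longrightarrow>
           (\<forall>x \<in> orthogonal_comp (null_space A). \<forall>c>0.
             ((\<lambda>\<delta>. SUP \<nu>\<in>scale_noise \<delta> (dominated_noise l c). mse_risk A s u v P (\<mu> \<delta>) x \<nu>)
               \<longlongrightarrow> 0) (at_right 0)))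
       \<and> ((\<forall>\<delta>>0. \<forall>n. noise_moment (\<mu> \<delta>) n = \<delta>\<^sup>2) \<longrightarrow>
           (\<forall>x \<in> orthogonal_comp (null_space A).
             ((\<lambda>\<delta>. SUP \<nu>\<in>{\<nu> \<in> continuous_noise s u v P. noise_level \<nu> \<le> ereal \<delta>}.
                  mse_risk A s u v P (\<mu> \<delta>) x \<nu>) \<longlongrightarrow> 0) (at_right 0)))"
proof -
  have data: "A x \<bullet> v n = s n * (x \<bullet> u n)" if "x \<in> orthogonal_comp (null_space A)" for x n
    using assms(3,5) that by (rule inner_singular_vector)
  have u: "orthonormal_seq u" and s: "0 < s n" for n
    using assms(5) by (auto simp: singular_system_def orthonormal_basis_of_def)
  have \<mu>: "noise_moment (\<mu> \<delta>) n \<le> \<delta>\<^sup>2" if "0 < \<delta>" for \<delta> n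
    by (rule noise_moment_le_level) (simp add: assms(9)[OF that])
  note limit = sup_mse_risk_tendsto_0[where A = A and v = v, OF data u s assms(6,7) _ \<mu>]
  show ?thesis
  proof (intro conjI allI impI ballI)
    fix l :: "nat \<Rightarrow> real" and x and c :: real
    assume l: "\<forall>\<delta>>0. \<forall>n. noise_moment (\<mu> \<delta>) n \<ge> \<delta>\<^sup>2 * l n"
      and x: "x \<in> orthogonal_comp (null_space A)" and c: "0 < c"
    show "((\<lambda>\<delta>. SUP \<nu>\<in>scale_noise \<delta> (dominated_noise l c). mse_risk A s u v P (\<mu> \<delta>) x \<nu>)
        \<longlongrightarrow> 0) (at_right 0)"
    proof (rule limit[OF x, where c = c])
      fix \<delta> :: real and \<nu>
      assume \<delta>: "0 < \<delta>" and "\<nu> \<in> scale_noise \<delta> (dominated_noise l c)"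
      then obtain \<nu>' where \<nu>': "noise_distribution \<nu>'" "\<And>n. noise_moment \<nu>' n \<le> c * l n"
        and \<nu>: "\<nu> = distr \<nu>' (Pi\<^sub>M UNIV (\<lambda>_. borel)) (\<lambda>e n. \<delta> * e n)"
        by (auto simp: scale_noise_def dominated_noise_def)
      show "noise_distribution \<nu>"
        unfolding \<nu> by (rule scaled_noise(1)[OF \<nu>'(1)])
      fix n
      have "noise_moment \<nu> n = \<delta>\<^sup>2 * noise_moment \<nu>' n"
        unfolding \<nu> by (rule scaled_noise(2)[OF \<nu>'(1)])
      also have "\<dots> \<le> \<delta>\<^sup>2 * (c * l n)"
        by (intro mult_left_mono \<nu>'(2)) simp
      also have "\<dots> = c * (\<delta>\<^sup>2 * l n)"
        by simp
      also have "\<dots> \<le> c * noise_moment (\<mu> \<delta>) n"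
        using l \<delta> c by (intro mult_left_mono) auto
      finally show "noise_moment \<nu> n \<le> c * noise_moment (\<mu> \<delta>) n" .
    qed (use c in auto)
  next
    fix x
    assume white: "\<forall>\<delta>>0. \<forall>n. noise_moment (\<mu> \<delta>) n = \<delta>\<^sup>2"
      and x: "x \<in> orthogonal_comp (null_space A)"
    show "((\<lambda>\<delta>. SUP \<nu>\<in>{\<nu> \<in> continuous_noise s u v P. noise_level \<nu> \<le> ereal \<delta>}.
        mse_risk A s u v P (\<mu> \<delta>) x \<nu>) \<longlongrightarrow> 0) (at_right 0)"
      by (rule limit[OF x, where c = 1])
        (use white noise_moment_le_level in \<open>auto simp: continuous_noise_def\<close>)
  qed
qed

end
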